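(* Let $\mu\ge\lambda>0$, let $\tau\ge 0$ be an integer, and let $F:\mathbb{R}^d\to\mathbb{R}$ be a $\mu$-smooth, $\lambda$-strongly convex quadratic function with minimizer $\mathbf{w}^*$. Let $\eta\in\left(0,\frac{1}{20\mu(\tau+1)}\right]$ and let $(\mathbf{w}_k)_{k\ge 0}$ be the iterates of delayed gradient descent (DGD) on $F$ with delay $\tau$, step size $\eta$ and initial point $\mathbf{w}_0$. Then for every integer $k\ge(\tau+1)\ln(2(\tau+1))$, $$F(\mathbf{w}_k)-F(\mathbf{w}^* )\le 5\mu\,(1-\eta\lambda)^{2(k+1)}\,\|\mathbf{w}_0-\mathbf{w}^*\|^2 .$$ In particular, if $\tau\ge1$ and $\eta=\Omega(1/(\mu\tau))$ (with $\eta\in\left(0,\frac{1}{20\mu(\tau+1)}\right]$), then $$F(\mathbf{w}_k)-F(\mathbf{w}^* )\le 5\mu\,\|\mathbf{w}_0-\mathbf{w}^*\|^2\exp\left(-\Omega\left(\frac{k\lambda}{\mu\tau}\right)\right);$$ that is, for every constant $c>0$ there is a constant $c'>0$ depending only on $c$ such that, whenever $\eta\ge c/(\mu\tau)$, the left-hand side is at most $5\mu\|\mathbf{w}_0-\mathbf{w}^*\|^2\exp(-c'k\lambda/(\mu\tau))$.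
   Context: A quadratic function is $F(\mathbf{w})=\frac12\mathbf{w}^\top A\mathbf{w}+\mathbf{b}^\top\mathbf{w}+c_0$ with $A\in\mathbb{R}^{d\times d}$ symmetric positive semidefinite, $\mathbf{b}\in\mathbb{R}^d$, $c_0\in\mathbb{R}$. It is $\mu$-smooth and $\lambda$-strongly convex when all eigenvalues of $A$ lie in $[\lambda,\mu]$. Norms are Euclidean. Delayed gradient descent (DGD) with delay $\tau$ and step size $\eta$: given $\mathbf{w}_0\in\mathbb{R}^d$, set $\mathbf{w}_0=\mathbf{w}_1=\dots=\mathbf{w}_\tau$, and for $k\ge\tau$ set $\mathbf{w}_{k+1}=\mathbf{w}_k-\eta\nabla F(\mathbf{w}_{k-\tau})$. *)

theory Defs
  imports
    "HOL-Analysis.Derivative"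
    "Jordan_Normal_Form.Char_Poly"
begin

text \<open>
  Vectors of the \<open>d\<close>-dimensional space are elements of \<open>carrier_vec d\<close> rather than of a type indexed
  by the dimension, so that constants can be chosen uniformly in \<open>d\<close>.
\<close>

definition l2_norm :: "real vec \<Rightarrow> real" where
  "l2_norm v = sqrt (v \<bullet> v)"

definition psd_quadratic :: "nat \<Rightarrow> real mat \<Rightarrow> real vec \<Rightarrow> real \<Rightarrow> (real vec \<Rightarrow> real) \<Rightarrow> bool" where
  "psd_quadratic d A b c0 F \<longleftrightarrow>
     A \<in> carrier_mat d d \<and> transpose_mat A = A \<and>
     (\<forall>v \<in> carrier_vec d. 0 \<le> v \<bullet> (A *\<^sub>v v)) \<and>
     b \<in> carrier_vec d \<and>
     (\<forall>w \<in> carrier_vec d. F w = 1/2 * (w \<bullet> (A *\<^sub>v w)) + b \<bullet> w + c0)"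

definition smooth_strongly_convex_quadratic ::
    "nat \<Rightarrow> real \<Rightarrow> real \<Rightarrow> (real vec \<Rightarrow> real) \<Rightarrow> bool" where
  "smooth_strongly_convex_quadratic d \<mu> lam F \<longleftrightarrow>
     (\<exists>A b c0. psd_quadratic d A b c0 F \<and> (\<forall>x. eigenvalue A x \<longrightarrow> x \<in> {lam..\<mu>}))"

definition grad :: "nat \<Rightarrow> (real vec \<Rightarrow> real) \<Rightarrow> real vec \<Rightarrow> real vec" where
  "grad d F w = vec d (\<lambda>i. deriv (\<lambda>t. F (w + t \<cdot>\<^sub>v unit_vec d i)) 0)"

fun dgd :: "nat \<Rightarrow> (real vec \<Rightarrow> real) \<Rightarrow> nat \<Rightarrow> real \<Rightarrow> real vec \<Rightarrow> nat \<Rightarrow> real vec" where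
  "dgd d F \<tau> \<eta> w0 0 = w0"
| "dgd d F \<tau> \<eta> w0 (Suc k) =
     (if k < \<tau> then w0
      else dgd d F \<tau> \<eta> w0 k - \<eta> \<cdot>\<^sub>v grad d F (dgd d F \<tau> \<eta> w0 (k - \<tau>)))"

end

theory Submission
  imports Defs "Jordan_Normal_Form.Schur_Decomposition"
begin

text \<open>
  In an orthonormal eigenbasis of the Hessian, delayed gradient descent decouples into scalar
  recursions \<open>x (k + 1) = x k - \<alpha> * x (k - \<tau>)\<close> with \<open>\<alpha> = \<eta> * a\<close> for an eigenvalue \<open>a\<close>, so
  \<open>20 * \<alpha> * (\<tau> + 1) \<le> 1\<close>. If \<open>x 0 \<ge> 0\<close>, then \<open>x\<close> is nonnegative and decreasing: it loses at most a
  factor \<open>1 - 2 * \<alpha>\<close> per step, so by Bernoulli's inequality \<open>x (k - \<tau>) \<le> 2 * x k\<close>, which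
  reproduces that factor. Monotonicity gives \<open>x (k - \<tau>) \<ge> x k\<close>, hence a contraction by \<open>1 - \<alpha>\<close>
  in every step after the first \<open>\<tau>\<close>; making up for these and one more costs only
  \<open>(1 - \<alpha>) ^ (\<tau> + 1) \<ge> 19 / 20\<close>.
\<close>

subsection \<open>Orthogonal diagonalization of real symmetric matrices\<close>

text \<open>The complexified matrix has a characteristic root \<open>z\<close> with an eigenvector
  \<open>v\<close>. It is Hermitian, so moving it across the inner product gives
  \<open>z * (v \<bullet>c v) = cnj z * (v \<bullet>c v)\<close>. Hence \<open>z\<close> is real and
  is a root of the real characteristic polynomial.\<close>

lemma symmetric_real_eigenvalue_exists:
  fixes A :: "real mat"
  assumes A: "A \<in> carrier_mat n n" and sym: "A\<^sup>T = A" and n: "n \<noteq> 0"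
  obtains e where "eigenvalue A e"
proof -
  let ?C = "map_mat complex_of_real A"
  have C: "?C \<in> carrier_mat n n" using A by simp
  obtain as where as: "char_poly ?C = (\<Prod>a\<leftarrow>as. [:- a, 1:])" "length as = n"
    using char_poly_factorized[OF C] by blast
  then obtain z where "z \<in> set as" using n by (cases as) auto
  then have root: "poly (char_poly ?C) z = 0"
    by (auto simp: as(1) poly_prod_list prod_list_zero_iff)
  then obtain v where v: "v \<in> carrier_vec n" "v \<noteq> 0\<^sub>v n" "?C *\<^sub>v v = z \<cdot>\<^sub>v v"
    using C unfolding eigenvalue_root_char_poly[OF C, symmetric] eigenvalue_def eigenvector_def
    by auto
  have symC: "?C\<^sup>T = ?C"
  proof (rule eq_matI)
    fix i j assume "i < dim_row ?C" "j < dim_col ?C"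
    then have "A\<^sup>T $$ (i, j) = A $$ (j, i)" "i < n" "j < n" using A by auto
    then show "?C\<^sup>T $$ (i, j) = ?C $$ (i, j)" using A by (simp add: sym)
  qed (use A in auto)
  have conj: "?C *\<^sub>v conjugate v = conjugate (?C *\<^sub>v v)"
    using A v(1) by (intro eq_vecI) (auto simp: scalar_prod_def conjugate_complex_def)
  have "z * (v \<bullet>c v) = (?C *\<^sub>v v) \<bullet>c v" using v by simp
  also have "\<dots> = v \<bullet> (?C *\<^sub>v conjugate v)"
    using transpose_vec_mult_scalar[OF C, of "conjugate v" v] v(1) symC
    by (metis C carrier_vec_conjugate comm_scalar_prod mult_mat_vec_carrier)
  also have "\<dots> = cnj z * (v \<bullet>c v)"
    unfolding conj v(3) using v(1) by (simp add: conjugate_smult_vec conjugate_complex_def)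
  finally have "z = cnj z" using conjugate_square_eq_0_vec[OF v(1)] v(2) by simp
  then obtain r where r: "z = complex_of_real r" by (metis Reals_cases Reals_cnj_iff)
  have "poly (map_poly complex_of_real (char_poly A)) (complex_of_real r) = 0"
    using root unfolding r of_real_hom.char_poly_hom[OF A] .
  then have "poly (char_poly A) r = 0" by simp
  then show thesis using that eigenvalue_root_char_poly[OF A] by blast
qed

text \<open>Complete \<open>v\<close> to a basis and orthogonalize, which keeps \<open>v\<close> as
  the first vector. This Gram-Schmidt process does not normalize, so \<open>u\<close> rescales the
  result, and \<open>c\<close> is the reciprocal of the norm of \<open>v\<close>.\<close>

lemma orthogonal_matrix_first_col:
  fixes v :: "real vec"
  assumes v: "v \<in> carrier_vec n" and v0: "v \<noteq> 0\<^sub>v n"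
  obtains W c where "W \<in> carrier_mat n n" "W\<^sup>T * W = 1\<^sub>m n" "col W 0 = c \<cdot>\<^sub>v v"
proof -
  interpret cof_vec_space n "TYPE(real)" .
  have n: "0 < n" using v v0 by (cases n) auto
  define b where "b = basis_completion v"
  note bc = basis_completion[OF v v0, folded b_def]
  define ws where "ws = gram_schmidt n b"
  note gs = gram_schmidt_result[OF bc(2,4,5) ws_def]
  have len: "length ws = n" using gs(4) bc(6) by simp
  have "b = v # tl b" using bc(6,7) n by (cases b) auto
  then have "hd ws = v" using gram_schmidt_hd[OF v] unfolding ws_def by metis
  then have ws0: "ws ! 0 = v" using len n by (metis hd_conv_nth length_0_conv less_irrefl)
  have wsc: "ws ! i \<in> carrier_vec n" if "i < n" for i using gs(3) len that by auto
  \<comment> \<open>The equivalence also contains \<open>ws ! i \<bullet> ws ! i \<noteq> 0\<close>,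
    so dividing by the norms is legitimate.\<close>
  have orth: "ws ! i \<bullet> ws ! j = 0 \<longleftrightarrow> i \<noteq> j" if "i < n" "j < n" for i j
    using corthogonalD[OF gs(2), of i j] that len by simp
  have pos: "0 < ws ! i \<bullet> ws ! i" if "i < n" for i
    using orth[OF that that] conjugate_square_ge_0_vec[of "ws ! i"] by simp
  define u where "u w = (1 / l2_norm w) \<cdot>\<^sub>v w" for w
  define W where "W = mat_of_cols n (map u ws)"
  have W: "W \<in> carrier_mat n n" unfolding W_def using len by auto
  have colW: "col W i = u (ws ! i)" if "i < n" for i
    unfolding W_def using that len wsc by (subst col_mat_of_cols) (auto simp: u_def)
  have "W\<^sup>T * W = 1\<^sub>m n"
  proof (rule eq_matI)
    fix i j assume "i < dim_row (1\<^sub>m n :: real mat)" "j < dim_col (1\<^sub>m n :: real mat)"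
    then have ij: "i < n" "j < n" by auto
    have "(W\<^sup>T * W) $$ (i, j) = u (ws ! i) \<bullet> u (ws ! j)" using ij W by (simp add: colW)
    also have "\<dots> = (ws ! i \<bullet> ws ! j) / (l2_norm (ws ! i) * l2_norm (ws ! j))"
      unfolding u_def using wsc[OF ij(1)] wsc[OF ij(2)] by simp
    also have "\<dots> = 1\<^sub>m n $$ (i, j)"
      using orth[OF ij] pos[OF ij(1)] ij by (auto simp: l2_norm_def)
    finally show "(W\<^sup>T * W) $$ (i, j) = 1\<^sub>m n $$ (i, j)" .
  qed (use W in auto)
  moreover have "col W 0 = (1 / l2_norm v) \<cdot>\<^sub>v v" using colW[OF n] ws0 by (simp add: u_def)
  ultimately show thesis using that W by blast
qed

text \<open>Deflation by induction on the dimension: an orthogonal change of basis puts an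
  eigenvector first. Symmetry carries the zeros of the first column over to the first row, so the
  matrix splits into the eigenvalue and a smaller symmetric block.\<close>

lemma symmetric_real_diagonalization:
  fixes A :: "real mat"
  assumes "A \<in> carrier_mat n n" and "A\<^sup>T = A"
  shows "\<exists>U a. U \<in> carrier_mat n n \<and> U\<^sup>T * U = 1\<^sub>m n \<and>
    U\<^sup>T * A * U = mat n n (\<lambda>(i, j). if i = j then a i else 0)"
  using assms
proof (induction n arbitrary: A)
  case 0
  then show ?case by (intro exI[of _ "1\<^sub>m 0"] exI[of _ "\<lambda>_. 0"]) (auto intro: eq_matI)
next
  case (Suc n)
  note A = Suc.prems(1) and sym = Suc.prems(2)
  let ?n = "Suc n"
  obtain e where "eigenvalue A e" using symmetric_real_eigenvalue_exists[OF A sym] by blast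
  then obtain v where v: "v \<in> carrier_vec ?n" "v \<noteq> 0\<^sub>v ?n" "A *\<^sub>v v = e \<cdot>\<^sub>v v"
    using A unfolding eigenvalue_def eigenvector_def by auto
  obtain W c where W: "W \<in> carrier_mat ?n ?n" and WW: "W\<^sup>T * W = 1\<^sub>m ?n" and W0: "col W 0 = c \<cdot>\<^sub>v v"
    using orthogonal_matrix_first_col[OF v(1,2)] by blast
  define B where "B = W\<^sup>T * A * W"
  have B: "B \<in> carrier_mat ?n ?n" unfolding B_def using A W by auto
  have symB: "B\<^sup>T = B"
    unfolding B_def using A W sym
    by (simp add: transpose_mult[of _ ?n ?n _ ?n] assoc_mult_mat[of _ ?n ?n _ ?n _ ?n])
  then have Bij: "B $$ (i, j) = B $$ (j, i)" if "i < ?n" "j < ?n" for i j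
    using B that by (metis carrier_matD index_transpose_mat(1))
  have AW0: "A *\<^sub>v col W 0 = e \<cdot>\<^sub>v col W 0"
    unfolding W0 using A v by (simp add: mult_mat_vec[of A ?n ?n] smult_smult_assoc mult.commute)
  have B0: "B $$ (i, 0) = (if i = 0 then e else 0)" if i: "i < ?n" for i
  proof -
    have "B = W\<^sup>T * (A * W)" unfolding B_def using A W by (simp add: assoc_mult_mat[of _ ?n ?n _ ?n _ ?n])
    then have "B $$ (i, 0) = col W i \<bullet> (A *\<^sub>v col W 0)" using A W i by (simp add: mult_mat_vec_def)
    also have "\<dots> = e * (col W i \<bullet> col W 0)" unfolding AW0 using W by simp
    also have "col W i \<bullet> col W 0 = (W\<^sup>T * W) $$ (i, 0)" using W i by simp
    finally show ?thesis unfolding WW using i by simp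
  qed
  define D where "D = mat n n (\<lambda>(i, j). B $$ (Suc i, Suc j))"
  have D: "D \<in> carrier_mat n n" unfolding D_def by simp
  have "D\<^sup>T = D" unfolding D_def by (rule eq_matI) (auto simp: Bij)
  from Suc.IH[OF D this] obtain V a where V: "V \<in> carrier_mat n n" "V\<^sup>T * V = 1\<^sub>m n"
    and VDV: "V\<^sup>T * D * V = mat n n (\<lambda>(i, j). if i = j then a i else 0)" by blast
  let ?E = "mat 1 1 (\<lambda>_. e)"
  have BD: "B = four_block_mat ?E (0\<^sub>m 1 n) (0\<^sub>m n 1) D" (is "_ = ?R")
  proof (rule eq_matI)
    fix i j assume "i < dim_row ?R" "j < dim_col ?R"
    then have "i < ?n" "j < ?n" using D by auto
    then show "B $$ (i, j) = ?R $$ (i, j)"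
      using B0[of i] B0[of j] Bij[of 0 j] D by (auto simp: D_def)
  qed (use B D in auto)
  \<comment> \<open>\<open>G\<close> leaves the first axis alone and diagonalizes the block
    \<open>D\<close>. The matrix sought is \<open>W * G\<close>, and \<open>case_nat e a\<close>
    puts the split-off eigenvalue before those of \<open>D\<close>.\<close>
  define G where "G = four_block_mat (1\<^sub>m 1) (0\<^sub>m 1 n) (0\<^sub>m n 1) V"
  have G: "G \<in> carrier_mat ?n ?n" unfolding G_def using V by auto
  have GT: "G\<^sup>T = four_block_mat (1\<^sub>m 1) (0\<^sub>m 1 n) (0\<^sub>m n 1) (V\<^sup>T)"
    unfolding G_def using V by (simp add: transpose_four_block_mat[of _ 1 1 _ n _ n])
  have GG: "G\<^sup>T * G = 1\<^sub>m ?n"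
    unfolding GT unfolding G_def using V
    by (simp add: mult_four_block_mat[of _ 1 1 _ n _ n _ _ 1 _ n])
  have "G\<^sup>T * B * G = four_block_mat ?E (0\<^sub>m 1 n) (0\<^sub>m n 1) (V\<^sup>T * D * V)"
    unfolding GT BD unfolding G_def using V D
    by (simp add: mult_four_block_mat[of _ 1 1 _ n _ n _ _ 1 _ n])
  also have "\<dots> = mat ?n ?n (\<lambda>(i, j). if i = j then case_nat e a i else 0)"
    unfolding VDV by (rule eq_matI) (auto split: nat.splits)
  finally have GBG: "G\<^sup>T * B * G = mat ?n ?n (\<lambda>(i, j). if i = j then case_nat e a i else 0)" .
  note assoc = assoc_mult_mat[of _ ?n ?n _ ?n _ ?n]
  have T: "(W * G)\<^sup>T = G\<^sup>T * W\<^sup>T" using W G by (rule transpose_mult)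
  have "(W * G)\<^sup>T * (W * G) = G\<^sup>T * ((W\<^sup>T * W) * G)"
    unfolding T using W G by (simp add: assoc)
  then have "(W * G)\<^sup>T * (W * G) = 1\<^sub>m ?n" using WW G GG by simp
  moreover have "(W * G)\<^sup>T * A * (W * G) = G\<^sup>T * B * G"
    unfolding T B_def using W G A by (simp add: assoc)
  ultimately show ?case using GBG W G by (intro exI[of _ "W * G"] exI[of _ "case_nat e a"]) auto
qed

text \<open>The form in which the spectral theorem is applied: with \<open>Q\<close> the transpose
  of the diagonalizing matrix, \<open>Q\<close> preserves inner products and turns \<open>A\<close>
  into coordinatewise multiplication by eigenvalues.\<close>

lemma symmetric_real_spectral_coordinates:
  fixes A :: "real mat"
  assumes A: "A \<in> carrier_mat n n" and sym: "A\<^sup>T = A"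
  obtains Q a where "Q \<in> carrier_mat n n"
    "\<And>i. i < n \<Longrightarrow> eigenvalue A (a i)"
    "\<And>v w. v \<in> carrier_vec n \<Longrightarrow> w \<in> carrier_vec n \<Longrightarrow> (Q *\<^sub>v v) \<bullet> (Q *\<^sub>v w) = v \<bullet> w"
    "\<And>v i. v \<in> carrier_vec n \<Longrightarrow> i < n \<Longrightarrow> (Q *\<^sub>v (A *\<^sub>v v)) $ i = a i * (Q *\<^sub>v v) $ i"
proof -
  obtain U a where U: "U \<in> carrier_mat n n" and UU: "U\<^sup>T * U = 1\<^sub>m n"
    and diag: "U\<^sup>T * A * U = mat n n (\<lambda>(i, j). if i = j then a i else 0)" (is "_ = ?D")
    using symmetric_real_diagonalization[OF A sym] by blast
  have UU': "U * U\<^sup>T = 1\<^sub>m n"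
    using mat_mult_left_right_inverse[OF _ U UU] U by simp
  note assoc = assoc_mult_mat[of _ n n _ n _ n]
  have "?D * U\<^sup>T = U\<^sup>T * A * (U * U\<^sup>T)" unfolding diag[symmetric] using U A by (simp add: assoc)
  then have UA: "U\<^sup>T * A = ?D * U\<^sup>T" unfolding UU' using U A by simp
  have coord: "(U\<^sup>T *\<^sub>v (A *\<^sub>v v)) $ i = a i * (U\<^sup>T *\<^sub>v v) $ i" if v: "v \<in> carrier_vec n" and i: "i < n" for v i
  proof -
    have "U\<^sup>T *\<^sub>v (A *\<^sub>v v) = (U\<^sup>T * A) *\<^sub>v v" using U A v by (simp add: assoc_mult_mat_vec[of _ n n _ n])
    also have "\<dots> = ?D *\<^sub>v (U\<^sup>T *\<^sub>v v)" unfolding UA using U v by (intro assoc_mult_mat_vec) auto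
    also have "\<dots> $ i = (\<Sum>j = 0..<n. (if i = j then a i else 0) * (U\<^sup>T *\<^sub>v v) $ j)"
      using i U by (simp add: scalar_prod_def)
    also have "\<dots> = (\<Sum>j = 0..<n. if i = j then a i * (U\<^sup>T *\<^sub>v v) $ j else 0)"
      by (rule sum.cong) auto
    also have "\<dots> = a i * (U\<^sup>T *\<^sub>v v) $ i" using i by simp
    finally show ?thesis .
  qed
  have iso: "(U\<^sup>T *\<^sub>v v) \<bullet> (U\<^sup>T *\<^sub>v w) = v \<bullet> w" if v: "v \<in> carrier_vec n" and w: "w \<in> carrier_vec n" for v w
  proof -
    have "(U\<^sup>T *\<^sub>v v) \<bullet> (U\<^sup>T *\<^sub>v w) = v \<bullet> (U *\<^sub>v (U\<^sup>T *\<^sub>v w))"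
      using U v w by (intro transpose_vec_mult_scalar) auto
    also have "U *\<^sub>v (U\<^sup>T *\<^sub>v w) = (U * U\<^sup>T) *\<^sub>v w"
      using U w by (simp add: assoc_mult_mat_vec[of _ n n _ n])
    finally show ?thesis unfolding UU' using w by simp
  qed
  have eig: "eigenvalue A (a i)" if i: "i < n" for i
  proof -
    have AU: "A * U = U * ?D"
    proof -
      have "U * ?D = (U * U\<^sup>T) * (A * U)" unfolding diag[symmetric] using U A by (simp add: assoc)
      then show ?thesis unfolding UU' using U A by simp
    qed
    have "A *\<^sub>v col U i = col (U * ?D) i" unfolding AU[symmetric] by (rule col_mult2[OF A U i, symmetric])
    also have "\<dots> = a i \<cdot>\<^sub>v col U i"
    proof (rule eq_vecI)
      fix k assume "k < dim_vec (a i \<cdot>\<^sub>v col U i)"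
      then have k: "k < n" using U by simp
      have "col (U * ?D) i $ k = (\<Sum>j = 0..<n. U $$ (k, j) * (if j = i then a j else 0))"
        using U i k by (simp add: scalar_prod_def)
      also have "\<dots> = (\<Sum>j = 0..<n. if j = i then U $$ (k, j) * a j else 0)"
        by (rule sum.cong) auto
      also have "\<dots> = U $$ (k, i) * a i" using i by simp
      finally show "col (U * ?D) i $ k = (a i \<cdot>\<^sub>v col U i) $ k" using U i k by simp
    qed (use U in simp)
    finally have "A *\<^sub>v col U i = a i \<cdot>\<^sub>v col U i" .
    moreover have "col U i \<noteq> 0\<^sub>v n"
    proof
      assume *: "col U i = 0\<^sub>v n"
      have "col U i \<bullet> col U i = (U\<^sup>T * U) $$ (i, i)" using U i by simp
      then show False unfolding UU using i * by simp
    qed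
    moreover have "col U i \<in> carrier_vec n" using U i by auto
    ultimately show ?thesis
      using A unfolding eigenvalue_def eigenvector_def by (intro exI[of _ "col U i"]) auto
  qed
  show thesis using that[of "U\<^sup>T" a] U eig iso coord by auto
qed

subsection \<open>The scalar delayed recursion\<close>

text \<open>The claims support one another, so they go through one strong induction: the lower ratio
  bounds at all earlier indices are chained to compare \<open>x (k - \<tau>)\<close> with
  \<open>x k\<close>. The constant 4 makes \<open>2 * \<alpha> * \<tau>\<close> at most one
  half.\<close>

lemma delayed_recursion_ratio:
  fixes x :: "nat \<Rightarrow> real"
  assumes x0: "0 \<le> x 0"
    and init: "\<And>k. k < \<tau> \<Longrightarrow> x (Suc k) = x k"
    and rec: "\<And>k. \<tau> \<le> k \<Longrightarrow> x (Suc k) = x k - \<alpha> * x (k - \<tau>)"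
    and \<alpha>: "0 \<le> \<alpha>" "4 * \<alpha> * (real \<tau> + 1) \<le> 1"
  shows "0 \<le> x k \<and> (1 - 2 * \<alpha>) * x k \<le> x (Suc k) \<and> x (Suc k) \<le> x k \<and>
    (\<tau> \<le> k \<longrightarrow> x (Suc k) \<le> (1 - \<alpha>) * x k)"
proof (induction k rule: less_induct)
  case (less k)
  have "0 \<le> \<alpha> * real \<tau>" using \<alpha>(1) by simp
  moreover have "4 * \<alpha> * (real \<tau> + 1) = 4 * (\<alpha> * real \<tau>) + 4 * \<alpha>" by (simp add: algebra_simps)
  ultimately have \<alpha>': "4 * \<alpha> \<le> 1" "4 * (\<alpha> * real \<tau>) \<le> 1" using \<alpha> by linarith+
  have nonneg: "0 \<le> x k"
  proof (cases k)
    case (Suc j)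
    then have "0 \<le> (1 - 2 * \<alpha>) * x j" using less[of j] \<alpha>' by simp
    then show ?thesis using less[of j] Suc by simp
  qed (use x0 in simp)
  show ?case
  proof (cases "k < \<tau>")
    case True
    then show ?thesis using nonneg init \<alpha>(1) by (simp add: algebra_simps)
  next
    case False
    \<comment> \<open>Chains the one-step bounds over the last \<open>m\<close> indices;
      \<open>m \<le> k\<close> keeps the subtraction from being truncated.\<close>
    have past: "(1 - 2 * \<alpha>) ^ m * x (k - m) \<le> x k \<and> x k \<le> x (k - m)" if "m \<le> k" for m
      using that
    proof (induction m)
      case (Suc m)
      let ?j = "k - Suc m"
      have j: "Suc ?j = k - m" "?j < k" using Suc.prems by auto
      have "(1 - 2 * \<alpha>) ^ Suc m * x ?j = (1 - 2 * \<alpha>) ^ m * ((1 - 2 * \<alpha>) * x ?j)" by simp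
      also have "\<dots> \<le> (1 - 2 * \<alpha>) ^ m * x (k - m)"
        using less[OF j(2)] \<alpha>' unfolding j(1) by (intro mult_left_mono) auto
      also have "\<dots> \<le> x k" using Suc by simp
      finally show ?case using less[OF j(2)] Suc unfolding j(1) by auto
    qed simp
    have "1 + real \<tau> * (- 2 * \<alpha>) \<le> (1 + (- 2 * \<alpha>)) ^ \<tau>"
      using \<alpha>' by (intro Bernoulli_inequality) auto
    then have half: "1 / 2 \<le> (1 - 2 * \<alpha>) ^ \<tau>" using \<alpha>' by (simp add: algebra_simps)
    have "0 \<le> x (k - \<tau>)" using past[of \<tau>] nonneg False by linarith
    then have "1 / 2 * x (k - \<tau>) \<le> (1 - 2 * \<alpha>) ^ \<tau> * x (k - \<tau>)"
      using half by (rule mult_right_mono[rotated])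
    \<comment> \<open>Inserted into the recursion, the first inequality says that the step loses at
      most \<open>2 * \<alpha> * x k\<close>, the second that it loses at least
      \<open>\<alpha> * x k\<close>.\<close>
    then have "x (k - \<tau>) \<le> 2 * x k" "x k \<le> x (k - \<tau>)" using past[of \<tau>] False by auto
    then have "\<alpha> * x (k - \<tau>) \<le> \<alpha> * (2 * x k)" "\<alpha> * x k \<le> \<alpha> * x (k - \<tau>)" "0 \<le> \<alpha> * x k"
      using \<alpha>(1) nonneg by (auto intro: mult_left_mono)
    then show ?thesis using rec[of k] False nonneg by (simp add: algebra_simps)
  qed
qed

text \<open>The factor 19/20 is the Bernoulli bound for \<open>(1 - \<alpha>) ^ Suc \<tau>\<close>.
  Paid once, it covers the constant initial phase and the extra power in
  \<open>Suc k\<close>.\<close>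

lemma delayed_recursion_bound:
  fixes x :: "nat \<Rightarrow> real"
  assumes init: "\<And>k. k < \<tau> \<Longrightarrow> x (Suc k) = x k"
    and rec: "\<And>k. \<tau> \<le> k \<Longrightarrow> x (Suc k) = x k - \<alpha> * x (k - \<tau>)"
    and \<alpha>: "0 \<le> \<alpha>" "20 * \<alpha> * (real \<tau> + 1) \<le> 1"
  shows "19 / 20 * \<bar>x k\<bar> \<le> (1 - \<alpha>) ^ Suc k * \<bar>x 0\<bar>"
proof -
  \<comment> \<open>The recursion is linear, so flipping the sign reduces to a nonnegative initial
    value.\<close>
  define y where "y k = (if 0 \<le> x 0 then x k else - x k)" for k
  have "0 \<le> \<alpha> * (real \<tau> + 1)" using \<alpha>(1) by simp
  then have \<alpha>4: "4 * \<alpha> * (real \<tau> + 1) \<le> 1" using \<alpha>(2) by (simp add: mult.assoc)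
  have ratio: "0 \<le> y k \<and> y (Suc k) \<le> y k \<and> (\<tau> \<le> k \<longrightarrow> y (Suc k) \<le> (1 - \<alpha>) * y k)" for k
    using delayed_recursion_ratio[of y \<tau> \<alpha> k] init rec \<alpha>(1) \<alpha>4 by (auto simp: y_def)
  have "\<alpha> \<le> \<alpha> * (real \<tau> + 1)" using \<alpha>(1) by (simp add: algebra_simps)
  then have \<alpha>1: "\<alpha> \<le> 1" using \<alpha>(2) by simp
  have "1 + real (Suc \<tau>) * (- \<alpha>) \<le> (1 + (- \<alpha>)) ^ Suc \<tau>"
    using \<alpha>1 by (intro Bernoulli_inequality) auto
  then have shift: "19 / 20 \<le> (1 - \<alpha>) ^ Suc \<tau>" using \<alpha>(2) by (simp add: algebra_simps)
  have "19 / 20 * y k \<le> (1 - \<alpha>) ^ Suc k * y 0"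
  proof (induction k)
    case 0
    show ?case using ratio[of 0] \<alpha>(2) \<open>\<alpha> \<le> \<alpha> * (real \<tau> + 1)\<close> by (intro mult_right_mono) auto
  next
    case (Suc k)
    show ?case
    proof (cases "\<tau> \<le> k")
      case True
      have "19 / 20 * y (Suc k) \<le> 19 / 20 * ((1 - \<alpha>) * y k)" using ratio[of k] True by simp
      also have "\<dots> = (1 - \<alpha>) * (19 / 20 * y k)" by simp
      also have "\<dots> \<le> (1 - \<alpha>) * ((1 - \<alpha>) ^ Suc k * y 0)" using Suc \<alpha>1 by (intro mult_left_mono) auto
      finally show ?thesis by simp
    next
      case False
      have const: "x j = x 0" if "j \<le> \<tau>" for j
        using that by (induction j) (auto simp: init Suc_le_eq)
      have "y (Suc k) = y 0" using const[of "Suc k"] False by (simp add: y_def)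
      \<comment> \<open>Here \<open>Suc (Suc k) \<le> Suc \<tau>\<close>, and powers of
        \<open>1 - \<alpha>\<close> decrease, so the bound for the largest exponent
        suffices.\<close>
      moreover have "19 / 20 \<le> (1 - \<alpha>) ^ Suc (Suc k)"
        using shift power_decreasing[of "Suc (Suc k)" "Suc \<tau>" "1 - \<alpha>"] \<alpha>(1) \<alpha>1 False by linarith
      ultimately show ?thesis using ratio[of 0] by (metis mult_right_mono)
    qed
  qed
  moreover have "y k = \<bar>x k\<bar>" "y 0 = \<bar>x 0\<bar>"
    using ratio[of k] by (auto simp: y_def split: if_splits)
  ultimately show ?thesis by simp
qed

subsection \<open>Quadratics and delayed gradient descent\<close>

text \<open>The exact second-order Taylor expansion; symmetry of \<open>A\<close> merges the two
  cross terms. It yields the gradient, stationarity of the minimizer, and the suboptimality as a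
  quadratic form.\<close>

lemma psd_quadratic_add:
  assumes F: "psd_quadratic d A b c0 F" and w: "w \<in> carrier_vec d" and h: "h \<in> carrier_vec d"
  shows "F (w + h) = F w + h \<bullet> (A *\<^sub>v w + b) + 1/2 * (h \<bullet> (A *\<^sub>v h))"
proof -
  have A: "A \<in> carrier_mat d d" and sym: "A\<^sup>T = A" and b: "b \<in> carrier_vec d"
    and Fv: "\<And>v. v \<in> carrier_vec d \<Longrightarrow> F v = 1/2 * (v \<bullet> (A *\<^sub>v v)) + b \<bullet> v + c0"
    using F unfolding psd_quadratic_def by auto
  have "w \<bullet> (A *\<^sub>v h) = (A *\<^sub>v w) \<bullet> h" using transpose_vec_mult_scalar[OF A h w] sym by simp
  also have "\<dots> = h \<bullet> (A *\<^sub>v w)" using A w h by (intro comm_scalar_prod) auto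
  finally have cross: "w \<bullet> (A *\<^sub>v h) = h \<bullet> (A *\<^sub>v w)" .
  have "b \<bullet> h = h \<bullet> b" using b h by (rule comm_scalar_prod)
  then show ?thesis
    using A b w h cross
    by (simp add: Fv mult_add_distrib_mat_vec[of A d d] add_scalar_prod_distrib[of _ d]
        scalar_prod_add_distrib[of _ d] algebra_simps)
qed

text \<open>Along a coordinate axis \<open>F\<close> is a quadratic polynomial in \<open>t\<close>,
  and its linear coefficient is the partial derivative in \<open>grad\<close>.\<close>

lemma grad_psd_quadratic:
  assumes F: "psd_quadratic d A b c0 F" and w: "w \<in> carrier_vec d"
  shows "grad d F w = A *\<^sub>v w + b"
proof (rule eq_vecI)
  have A: "A \<in> carrier_mat d d" and b: "b \<in> carrier_vec d"
    using F unfolding psd_quadratic_def by auto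
  then show "dim_vec (grad d F w) = dim_vec (A *\<^sub>v w + b)" by (simp add: grad_def)
  fix i assume "i < dim_vec (A *\<^sub>v w + b)"
  then have i: "i < d" using b by simp
  let ?u = "unit_vec d i :: real vec" and ?g = "A *\<^sub>v w + b"
  have g: "?g \<in> carrier_vec d" using A b w by auto
  have "F (w + t \<cdot>\<^sub>v ?u) = F w + t * (?g $ i) + 1/2 * (t * (t * (?u \<bullet> (A *\<^sub>v ?u))))" for t
    using psd_quadratic_add[OF F w, of "t \<cdot>\<^sub>v ?u"] A g i
    by (simp add: mult_mat_vec[of A d d] scalar_prod_left_unit[OF g i] del: index_add_vec)
  then have "(\<lambda>t. F (w + t \<cdot>\<^sub>v ?u)) =
      (\<lambda>t. F w + t * (?g $ i) + 1/2 * (t * (t * (?u \<bullet> (A *\<^sub>v ?u)))))" by blast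
  moreover have "((\<lambda>t. F w + t * (?g $ i) + 1/2 * (t * (t * (?u \<bullet> (A *\<^sub>v ?u)))))
      has_field_derivative ?g $ i) (at 0)"
    by (auto intro!: derivative_eq_intros)
  ultimately have "deriv (\<lambda>t. F (w + t \<cdot>\<^sub>v ?u)) 0 = ?g $ i" by (simp add: DERIV_imp_deriv)
  then show "grad d F w $ i = ?g $ i" using i by (simp add: grad_def)
qed

text \<open>If the gradient \<open>g\<close> were nonzero, a suitable step along its negative would
  lower \<open>F\<close>.\<close>

lemma psd_quadratic_arg_min_stationary:
  assumes F: "psd_quadratic d A b c0 F" and min: "is_arg_min F (\<lambda>w. w \<in> carrier_vec d) w"
  shows "A *\<^sub>v w + b = 0\<^sub>v d"
proof (rule ccontr)
  have A: "A \<in> carrier_mat d d" and b: "b \<in> carrier_vec d"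
    and psd: "\<And>v. v \<in> carrier_vec d \<Longrightarrow> 0 \<le> v \<bullet> (A *\<^sub>v v)"
    using F unfolding psd_quadratic_def by auto
  have w: "w \<in> carrier_vec d" using min by (simp add: is_arg_min_def)
  define g where "g = A *\<^sub>v w + b"
  have g: "g \<in> carrier_vec d" unfolding g_def using A b w by auto
  assume "A *\<^sub>v w + b \<noteq> 0\<^sub>v d"
  then have p: "0 < g \<bullet> g" using conjugate_square_greater_0_vec[OF g] unfolding g_def by simp
  \<comment> \<open>The exact line search step \<open>p / q\<close> breaks down when
    \<open>q = 0\<close>. The step \<open>p / (p + q)\<close> is always defined and satisfies
    \<open>s * q \<le> p\<close>, so \<open>F\<close> drops by at least
    \<open>s * p / 2\<close>.\<close>
  define p q s where "p = g \<bullet> g" and "q = g \<bullet> (A *\<^sub>v g)" and "s = p / (p + q)"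
  have q: "0 \<le> q" unfolding q_def by (rule psd[OF g])
  have s: "0 < s" "s * q \<le> p"
    using p q unfolding s_def p_def[symmetric] by (auto simp: field_simps)
  have "F (w + (- s) \<cdot>\<^sub>v g) = F w - s * p + 1/2 * (s * (s * q))"
    using psd_quadratic_add[OF F w, of "(- s) \<cdot>\<^sub>v g"] A g
    by (simp add: mult_mat_vec[of A d d] p_def q_def g_def[symmetric])
  moreover have "s * (s * q) \<le> s * p" "0 < s * p" using s p by (auto simp: p_def)
  ultimately have "F (w + (- s) \<cdot>\<^sub>v g) < F w" by linarith
  then show False using min w g unfolding is_arg_min_def by auto
qed

lemma l2_norm_squared: "(l2_norm v)\<^sup>2 = v \<bullet> v"
  using conjugate_square_ge_0_vec[of v] by (simp add: l2_norm_def)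

section \<open>Convergence rates of delayed gradient descent\<close>

lemma step_size_bound:
  fixes \<mu> \<eta> :: real
  assumes "0 < \<mu>" and "\<eta> \<in> {0<..1 / (20 * \<mu> * (real \<tau> + 1))}"
  shows "20 * (\<eta> * \<mu>) * (real \<tau> + 1) \<le> 1"
proof -
  have "0 < 20 * \<mu> * (real \<tau> + 1)" using assms(1) by simp
  then have "\<eta> * (20 * \<mu> * (real \<tau> + 1)) \<le> 1" using assms(2) by (simp add: pos_le_divide_eq)
  then show ?thesis by (simp add: mult_ac)
qed

text \<open>Each spectral coordinate of the error obeys the scalar recursion with
  \<open>\<alpha> = \<eta> * a i\<close>. The bounds are summed with weights
  \<open>a i \<le> \<mu>\<close>, and the isometry turns the sum of initial squares back into the
  squared distance.\<close>

lemma dgd_suboptimality: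
  assumes lam: "0 < lam" "lam \<le> \<mu>"
    and F: "smooth_strongly_convex_quadratic d \<mu> lam F"
    and min: "is_arg_min F (\<lambda>w. w \<in> carrier_vec d) wstar"
    and w0: "w0 \<in> carrier_vec d"
    and \<eta>: "\<eta> \<in> {0<..1 / (20 * \<mu> * (real \<tau> + 1))}"
  shows "F (dgd d F \<tau> \<eta> w0 k) - F wstar
    \<le> 5 * \<mu> * (1 - \<eta> * lam) ^ (2 * (k + 1)) * (l2_norm (w0 - wstar))\<^sup>2"
proof -
  obtain A b c0 where Q: "psd_quadratic d A b c0 F"
    and spec: "\<And>x. eigenvalue A x \<Longrightarrow> lam \<le> x \<and> x \<le> \<mu>"
    using F unfolding smooth_strongly_convex_quadratic_def by auto
  have A: "A \<in> carrier_mat d d" and sym: "A\<^sup>T = A" and b: "b \<in> carrier_vec d"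
    using Q unfolding psd_quadratic_def by auto
  have ws: "wstar \<in> carrier_vec d" using min by (simp add: is_arg_min_def)
  have stat: "A *\<^sub>v wstar + b = 0\<^sub>v d" by (rule psd_quadratic_arg_min_stationary[OF Q min])
  define W where "W = dgd d F \<tau> \<eta> w0"
  have W: "W k \<in> carrier_vec d" for k
    unfolding W_def by (induction k) (auto simp: w0 grad_def)
  \<comment> \<open>Centring at the minimizer removes the affine term: the gradient at
    \<open>W k\<close> becomes \<open>A *\<^sub>v e k\<close>.\<close>
  define e where "e k = W k - wstar" for k
  have e: "e k \<in> carrier_vec d" for k unfolding e_def using W ws by simp
  have gradW: "grad d F (W k) = A *\<^sub>v e k" for k
  proof -
    have "W k = e k + wstar" unfolding e_def using W[of k] ws by (intro eq_vecI) auto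
    then have "A *\<^sub>v W k = A *\<^sub>v e k + A *\<^sub>v wstar"
      using mult_add_distrib_mat_vec[OF A e ws] by simp
    then have "A *\<^sub>v W k + b = A *\<^sub>v e k + (A *\<^sub>v wstar + b)"
      using A e ws b by (simp add: assoc_add_vec[of _ d])
    then show ?thesis using grad_psd_quadratic[OF Q W] stat A e by simp
  qed
  obtain P a where P: "P \<in> carrier_mat d d"
    and eig: "\<And>i. i < d \<Longrightarrow> eigenvalue A (a i)"
    and iso: "\<And>v w. v \<in> carrier_vec d \<Longrightarrow> w \<in> carrier_vec d \<Longrightarrow> (P *\<^sub>v v) \<bullet> (P *\<^sub>v w) = v \<bullet> w"
    and coord: "\<And>v i. v \<in> carrier_vec d \<Longrightarrow> i < d \<Longrightarrow> (P *\<^sub>v (A *\<^sub>v v)) $ i = a i * (P *\<^sub>v v) $ i"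
    using symmetric_real_spectral_coordinates[OF A sym] by metis
  define x where "x i k = (P *\<^sub>v e k) $ i" for i k
  define \<rho> where "\<rho> = 1 - \<eta> * lam"
  have bound: "a i * (x i k)\<^sup>2 \<le> \<mu> * (10 * (\<rho> ^ (2 * (k + 1)) * (x i 0)\<^sup>2))" if i: "i < d" for i
  proof -
    have ai: "lam \<le> a i" "a i \<le> \<mu>" using spec[OF eig[OF i]] by auto
    have "20 * (\<eta> * \<mu>) * (real \<tau> + 1) \<le> 1" using step_size_bound[OF _ \<eta>] lam by simp
    moreover have "\<eta> * a i * (real \<tau> + 1) \<le> \<eta> * \<mu> * (real \<tau> + 1)"
      using ai \<eta> by (intro mult_right_mono mult_left_mono) auto
    ultimately have \<alpha>: "20 * (\<eta> * a i) * (real \<tau> + 1) \<le> 1" by linarith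
    have \<alpha>0: "0 \<le> \<eta> * a i" using ai \<eta> lam by simp
    have "\<eta> * a i \<le> \<eta> * a i * (real \<tau> + 1)" using mult_left_mono[of 1 "real \<tau> + 1" "\<eta> * a i"] \<alpha>0 by simp
    then have \<alpha>1: "\<eta> * a i \<le> 1" using \<alpha> by linarith
    have init: "x i (Suc j) = x i j" if "j < \<tau>" for j
    proof -
      have "W m = w0" if "m \<le> \<tau>" for m using that by (cases m) (auto simp: W_def)
      then show ?thesis using that unfolding x_def e_def by simp
    qed
    have rec: "x i (Suc j) = x i j - \<eta> * a i * x i (j - \<tau>)" if "\<tau> \<le> j" for j
    proof -
      have "W (Suc j) = W j - \<eta> \<cdot>\<^sub>v (A *\<^sub>v e (j - \<tau>))"
        using that gradW[of "j - \<tau>"] unfolding W_def by simp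
      then have "e (Suc j) = e j - \<eta> \<cdot>\<^sub>v (A *\<^sub>v e (j - \<tau>))"
        unfolding e_def[of "Suc j"] e_def[of j] using W[of j] ws A e by (intro eq_vecI) auto
      then have "P *\<^sub>v e (Suc j) = P *\<^sub>v e j - \<eta> \<cdot>\<^sub>v (P *\<^sub>v (A *\<^sub>v e (j - \<tau>)))"
        using P A e by (simp add: mult_minus_distrib_mat_vec[of P d d] mult_mat_vec[of P d d])
      then show ?thesis unfolding x_def using coord[OF e i, of "j - \<tau>"] P i
        by (simp del: index_mult_mat_vec)
    qed
    have "19 / 20 * \<bar>x i k\<bar> \<le> (1 - \<eta> * a i) ^ Suc k * \<bar>x i 0\<bar>"
      by (rule delayed_recursion_bound[OF init rec \<alpha>0 \<alpha>])
    \<comment> \<open>Since \<open>lam \<le> a i\<close>, the smallest admissible eigenvalue gives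
      the slowest rate; \<open>\<alpha>1\<close> keeps the base \<open>1 - \<eta> * a i\<close>
      nonnegative.\<close>
    also have "\<dots> \<le> \<rho> ^ Suc k * \<bar>x i 0\<bar>"
      unfolding \<rho>_def using ai \<eta> \<alpha>1 by (intro mult_right_mono power_mono) auto
    finally have "(19 / 20 * \<bar>x i k\<bar>)\<^sup>2 \<le> (\<rho> ^ Suc k * \<bar>x i 0\<bar>)\<^sup>2"
      by (intro power_mono) auto
    moreover have "(\<rho> ^ Suc k)\<^sup>2 = \<rho> ^ (2 * (k + 1))"
      by (simp only: power_mult[symmetric] mult.commute[of 2] Suc_eq_plus1)
    moreover have "(19 / 20 * \<bar>x i k\<bar>)\<^sup>2 = 361 / 400 * (x i k)\<^sup>2"
      by (simp add: power_mult_distrib power_divide)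
    ultimately have "361 / 400 * (x i k)\<^sup>2 \<le> \<rho> ^ (2 * (k + 1)) * (x i 0)\<^sup>2"
      by (simp only: power_mult_distrib power2_abs)
    moreover have "0 \<le> (x i k)\<^sup>2" by simp
    \<comment> \<open>The factor 400/361 is rounded up to 10, which together with the 1/2 of the
      quadratic form produces the constant 5.\<close>
    ultimately have "(x i k)\<^sup>2 \<le> 10 * (\<rho> ^ (2 * (k + 1)) * (x i 0)\<^sup>2)" by linarith
    then show ?thesis using ai lam by (intro mult_mono) auto
  qed
  \<comment> \<open>Expanding around \<open>wstar\<close>, where the linear term vanishes by
    \<open>stat\<close>, leaves only half the quadratic form of the error.\<close>
  have "wstar + e k = W k" unfolding e_def using W[of k] ws by (intro eq_vecI) auto
  then have "F (W k) - F wstar = 1/2 * (e k \<bullet> (A *\<^sub>v e k))"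
    using psd_quadratic_add[OF Q ws e, of k] e[of k] by (simp add: stat)
  also have "e k \<bullet> (A *\<^sub>v e k) = (P *\<^sub>v e k) \<bullet> (P *\<^sub>v (A *\<^sub>v e k))"
    using iso[OF e, of "A *\<^sub>v e k" k] A e by simp
  also have "\<dots> = (\<Sum>i = 0..<d. (P *\<^sub>v e k) $ i * (P *\<^sub>v (A *\<^sub>v e k)) $ i)"
    using P by (simp add: scalar_prod_def[of "P *\<^sub>v e k"] del: index_mult_mat_vec)
  also have "\<dots> = (\<Sum>i = 0..<d. a i * (x i k)\<^sup>2)"
    using coord[OF e] by (intro sum.cong) (auto simp: x_def power2_eq_square simp del: index_mult_mat_vec)
  also have "1/2 * \<dots> \<le> 1/2 * (\<Sum>i = 0..<d. \<mu> * (10 * (\<rho> ^ (2 * (k + 1)) * (x i 0)\<^sup>2)))"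
    using bound by (intro mult_left_mono sum_mono) auto
  also have "\<dots> = 5 * \<mu> * \<rho> ^ (2 * (k + 1)) * (\<Sum>i = 0..<d. (x i 0)\<^sup>2)"
    by (simp add: sum_distrib_left algebra_simps)
  also have "(\<Sum>i = 0..<d. (x i 0)\<^sup>2) = (P *\<^sub>v e 0) \<bullet> (P *\<^sub>v e 0)"
    using P by (simp add: scalar_prod_def[of "P *\<^sub>v e 0"] x_def power2_eq_square del: index_mult_mat_vec)
  also have "\<dots> = (l2_norm (w0 - wstar))\<^sup>2"
    unfolding l2_norm_squared iso[OF e e] by (simp add: e_def W_def)
  finally show ?thesis unfolding W_def \<rho>_def .
qed

text \<open>Apply \<open>1 - t \<le> exp (- t)\<close> with \<open>t = \<eta> * lam\<close>, then
  the lower bound on \<open>\<eta>\<close>, and weaken \<open>k + 1\<close> to \<open>k\<close>.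
  Taking powers is monotone because \<open>\<eta> * lam \<le> 1\<close>.\<close>

lemma dgd_suboptimality_exp:
  assumes lam: "0 < lam" "lam \<le> \<mu>"
    and F: "smooth_strongly_convex_quadratic d \<mu> lam F"
    and min: "is_arg_min F (\<lambda>w. w \<in> carrier_vec d) wstar"
    and w0: "w0 \<in> carrier_vec d"
    and \<eta>: "\<eta> \<in> {0<..1 / (20 * \<mu> * (real \<tau> + 1))}"
    and \<tau>: "1 \<le> \<tau>" and c: "c / (\<mu> * real \<tau>) \<le> \<eta>"
  shows "F (dgd d F \<tau> \<eta> w0 k) - F wstar
    \<le> 5 * \<mu> * (l2_norm (w0 - wstar))\<^sup>2 * exp (- (2 * c * real k * lam / (\<mu> * real \<tau>)))"
proof -
  have "20 * (\<eta> * \<mu>) * (real \<tau> + 1) \<le> 1" using step_size_bound[OF _ \<eta>] lam by simp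
  moreover have "\<eta> * lam \<le> \<eta> * \<mu>" "0 \<le> \<eta> * \<mu>" "0 \<le> \<eta> * \<mu> * real \<tau>" using \<eta> lam by auto
  ultimately have \<eta>lam: "\<eta> * lam \<le> 1" by (simp add: algebra_simps)
  have "(1 - \<eta> * lam) ^ (2 * (k + 1)) \<le> exp (- (\<eta> * lam)) ^ (2 * (k + 1))"
    using \<eta>lam exp_ge_add_one_self[of "- (\<eta> * lam)"] by (intro power_mono) auto
  also have "\<dots> = exp (- (\<eta> * (lam * (2 * (real k + 1)))))"
    by (simp only: exp_of_nat_mult[symmetric]) (simp add: algebra_simps)
  also have "\<dots> \<le> exp (- (2 * c * real k * lam / (\<mu> * real \<tau>)))"
  proof -
    have "c / (\<mu> * real \<tau>) * (lam * (2 * real k)) \<le> \<eta> * (lam * (2 * real k))"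
      using c lam by (intro mult_right_mono) auto
    also have "\<dots> \<le> \<eta> * (lam * (2 * (real k + 1)))"
      using \<eta> lam by (intro mult_left_mono) auto
    finally show ?thesis by (simp add: algebra_simps)
  qed
  finally have "5 * \<mu> * (l2_norm (w0 - wstar))\<^sup>2 * (1 - \<eta> * lam) ^ (2 * (k + 1))
      \<le> 5 * \<mu> * (l2_norm (w0 - wstar))\<^sup>2 * exp (- (2 * c * real k * lam / (\<mu> * real \<tau>)))"
    using lam by (intro mult_left_mono) auto
  then show ?thesis
    using dgd_suboptimality[OF lam F min w0 \<eta>, of k] by (simp add: mult.assoc mult.left_commute mult.commute)
qed

theorem theorem1:
  shows "(\<forall>(d::nat) (\<mu>::real) (lam::real) (\<tau>::nat) (\<eta>::real) F wstar w0 (k::nat).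
            0 < lam \<longrightarrow> lam \<le> \<mu> \<longrightarrow>
            smooth_strongly_convex_quadratic d \<mu> lam F \<longrightarrow>
            is_arg_min F (\<lambda>w. w \<in> carrier_vec d) wstar \<longrightarrow>
            w0 \<in> carrier_vec d \<longrightarrow>
            \<eta> \<in> {0<..1 / (20 * \<mu> * (real \<tau> + 1))} \<longrightarrow>
            real k \<ge> (real \<tau> + 1) * ln (2 * (real \<tau> + 1)) \<longrightarrow>
            F (dgd d F \<tau> \<eta> w0 k) - F wstar
              \<le> 5 * \<mu> * (1 - \<eta> * lam) ^ (2 * (k + 1)) * (l2_norm (w0 - wstar))\<^sup>2)
       \<and> (\<forall>c>0. \<exists>c'>0.
            \<forall>(d::nat) (\<mu>::real) (lam::real) (\<tau>::nat) (\<eta>::real) F wstar w0 (k::nat).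
            0 < lam \<longrightarrow> lam \<le> \<mu> \<longrightarrow>
            smooth_strongly_convex_quadratic d \<mu> lam F \<longrightarrow>
            is_arg_min F (\<lambda>w. w \<in> carrier_vec d) wstar \<longrightarrow>
            w0 \<in> carrier_vec d \<longrightarrow>
            \<tau> \<ge> 1 \<longrightarrow>
            \<eta> \<in> {0<..1 / (20 * \<mu> * (real \<tau> + 1))} \<longrightarrow>
            \<eta> \<ge> c / (\<mu> * real \<tau>) \<longrightarrow>
            real k \<ge> (real \<tau> + 1) * ln (2 * (real \<tau> + 1)) \<longrightarrow>
            F (dgd d F \<tau> \<eta> w0 k) - F wstar
              \<le> 5 * \<mu> * (l2_norm (w0 - wstar))\<^sup>2
                  * exp (- (c' * real k * lam / (\<mu> * real \<tau>))))"
proof (intro conjI allI impI)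
  \<comment> \<open>The witness is \<open>2 * c\<close>: the 2 comes from the exponent
    \<open>2 * (k + 1)\<close>, that is, from squaring the contraction of the error.\<close>
  fix c :: real assume "0 < c"
  then show "\<exists>c'>0. \<forall>(d::nat) (\<mu>::real) (lam::real) (\<tau>::nat) (\<eta>::real) F wstar w0 (k::nat).
            0 < lam \<longrightarrow> lam \<le> \<mu> \<longrightarrow>
            smooth_strongly_convex_quadratic d \<mu> lam F \<longrightarrow>
            is_arg_min F (\<lambda>w. w \<in> carrier_vec d) wstar \<longrightarrow>
            w0 \<in> carrier_vec d \<longrightarrow>
            \<tau> \<ge> 1 \<longrightarrow>
            \<eta> \<in> {0<..1 / (20 * \<mu> * (real \<tau> + 1))} \<longrightarrow>
            \<eta> \<ge> c / (\<mu> * real \<tau>) \<longrightarrow>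
            real k \<ge> (real \<tau> + 1) * ln (2 * (real \<tau> + 1)) \<longrightarrow>
            F (dgd d F \<tau> \<eta> w0 k) - F wstar
              \<le> 5 * \<mu> * (l2_norm (w0 - wstar))\<^sup>2
                  * exp (- (c' * real k * lam / (\<mu> * real \<tau>)))"
    by (intro exI[of _ "2 * c"] conjI allI impI dgd_suboptimality_exp) auto
qed (rule dgd_suboptimality)

end
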